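(* Let $\phi:\mathbb{R}^n\to\mathbb{R}$ be convex and $1/\gamma$ smooth, let $g:\mathbb{R}^m\to\mathbb{R}\cup\{+\infty\}$ be convex and $\lambda$ strongly convex (with $\gamma,\lambda>0$), let $A\in\mathbb{R}^{n\times n}$ be a square invertible matrix, and let $B\in\mathbb{R}^{n\times m}$, $c\in\mathbb{R}^n$, $\rho>0$. Let $G\in\mathbb{R}^{m\times m}$ and $H\in\mathbb{R}^{n\times n}$ be symmetric positive semi-definite, and write $H=A^\top\tilde H A$ with $\tilde H\in\mathbb{R}^{n\times n}$ symmetric positive semi-definite. Let $\sigma_{\min}(H)$ be the smallest eigenvalue of $H$ and $\sigma_{\max}(\tilde H)$ the largest eigenvalue of $\tilde H$, and assume $\sigma_{\min}(H)\ge\gamma^{-1}$. Let $\sigma_{\min}(A)$ be the smallest eigenvalue of $(AA^\top)^{1/2}$, and let $\sigma_{\max}(B)$, $\sigma_{\max}(G)$ be the largest singular values of $B$ and $G$. Let $s\in[0,1)$ and $\theta>0$ satisfy $$\theta\le\min\left(\frac{\rho\,\sigma_{\min}(A)^2}{\sigma_{\min}(H)},\ \frac{s\rho}{\sigma_{\max}(\tilde H)},\ \frac{(1-s)\lambda}{(\rho+\sigma_{\max}(\tilde H))\sigma_{\max}(B)^2+(1-s)\rho\,\sigma_{\max}(G)}\right).$$ Let $(w_*,v_*,\alpha_* )$ be an optimal solution of $\min_{w,v}[\phi(w)+g(v)]$ subject to $Aw-Bv=c$, in the sense that $$Aw_*-Bv_*-c=0,\quad A^\top\alpha_*=-\nabla\phi(w_*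 ),\quad w_*=\nabla\phi^*(-A^\top\alpha_* ),\quad B^\top\alpha_*=\nabla g(v_* ).$$ Let $(v^t,w^t,\alpha^t)_{t\ge1}$ be generated from arbitrary $w^0\in\mathbb{R}^n$, $v^0\in\mathbb{R}^m$, $\alpha^0\in\mathbb{R}^n$ by the preconditioned linearized ADMM algorithm (defined in the context), and let $\tilde\alpha^t=\alpha^t+\tilde HA(w^t-w^{t-1})$ for $t\ge1$. Then for every $T\ge1$, $$\sum_{t=1}^T(1+\theta)^{t-T}\Big[\max\big(D_\phi(w_*,w^{t-1}),\,D_{\phi^*}(-A^\top\alpha_*,-A^\top\tilde\alpha^t)\big)+D_g(v_*,v^t)\Big]$$ $$+\frac12\|w^T-w_*\|_H^2+\frac{\rho}{2}\|A(w^T-w_* )\|_2^2+\frac{1+\theta}{2\rho}\|\alpha^T-\alpha_*\|_2^2+\frac{\rho(1+\theta)}{2}\|v^T-v_*\|_G^2$$ $$\le\frac{(1+\theta)^{-T}}{2}\left[(\rho+\sigma_{\max}(\tilde H))\|A(w^0-w_* )\|_2^2+\frac{1+\theta}{\rho}\|\alpha^0-\alpha_*\|_2^2+\rho(1+\theta)\|v^0-v_*\|_G^2\right].$$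
   Context: For a symmetric positive semi-definite matrix $M$, $\|x\|_M^2=x^\top Mx$. Preconditioned linearized ADMM: with $$\phi_H(w^{t-1};w)=\phi(w^{t-1})+\nabla\phi(w^{t-1})^\top(w-w^{t-1})+\tfrac12(w-w^{t-1})^\top H(w-w^{t-1}),$$ given $w^0,v^0,\alpha^0$, for $t=1,2,\ldots$, $$v^t=\arg\min_v\Big[g(v)-(\alpha^{t-1})^\top Bv+\tfrac{\rho}{2}\|Aw^{t-1}-Bv-c\|_2^2+\tfrac{\rho}{2}\|v-v^{t-1}\|_G^2\Big],$$ $$w^t=\arg\min_w\Big[\phi_H(w^{t-1};w)+(\alpha^{t-1})^\top Aw+\tfrac{\rho}{2}\|Aw-Bv^t-c\|_2^2\Big],$$ $$\alpha^t=\alpha^{t-1}+\rho(Aw^t-Bv^t-c).$$ The minimizers are assumed to exist. For a convex function $h$, $h^*(\beta)=\sup_u[\beta^\top u-h(u)]$ is the convex conjugate, and $D_h(u',u)=h(u)-h(u')-\nabla h(u')^\top(u-u')$ is the Bregman divergence. "$\phi$ is $1/\gamma$ smooth" means $\phi$ is differentiable with $D_\phi(w',w)\le\frac{1}{2\gamma}\|w'-w\|_2^2$ for all $w,w'$. "$g$ is $\lambda$ strongly convex" means $D_g(v',v)\ge\frac{\lambda}{2}\|v'-v\|_2^2$ for all $v,v'$; $g$ may be nondifferentiable or take the value $+\infty$ (but is not identically $+\infty$), in which case $\nabla g(v')$ stands for any subgradient at $v'$. If $g$ or $\phi^*$ is not differentiable, the optimality relations are read as $B^\top\alpha_*\in\partial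 g(v_* )$ and $w_*\in\partial\phi^*(-A^\top\alpha_* )$, and the subgradients used in $D_g(v_*,\cdot)$ and $D_{\phi^*}(-A^\top\alpha_*,\cdot)$ are $B^\top\alpha_*$ and $w_*$ respectively. A fraction with zero denominator in the bound on $\theta$ is read as $+\infty$. *)

theory Defs
  imports "HOL-Analysis.Analysis"
begin

definition sym_psd :: "real^'n^'n \<Rightarrow> bool" where
  "sym_psd M \<longleftrightarrow> transpose M = M \<and> (\<forall>x. 0 \<le> x \<bullet> (M *v x))"

definition wnorm_sq :: "real^'n^'n \<Rightarrow> real^'n \<Rightarrow> real" where
  "wnorm_sq M x = x \<bullet> (M *v x)"

definition eigenvalues :: "real^'n^'n \<Rightarrow> real set" where
  "eigenvalues M = {\<mu>. \<exists>x. x \<noteq> 0 \<and> M *v x = \<mu> *\<^sub>R x}"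

text \<open>The extremal eigenvalues are only used for symmetric matrices, for which the set of
  real eigenvalues is finite and nonempty, so that \<open>Min\<close> and \<open>Max\<close> are meaningful.\<close>

definition min_eigenvalue :: "real^'n^'n \<Rightarrow> real" where
  "min_eigenvalue M = Min (eigenvalues M)"

definition max_eigenvalue :: "real^'n^'n \<Rightarrow> real" where
  "max_eigenvalue M = Max (eigenvalues M)"

definition singular_values :: "real^'m^'n \<Rightarrow> real set" where
  "singular_values M = sqrt ` eigenvalues (transpose M ** M)"

definition max_singular_value :: "real^'m^'n \<Rightarrow> real" where
  "max_singular_value M = Max (singular_values M)"

text \<open>The square root of a symmetric positive semi-definite matrix, i.e. its unique symmetric
  positive semi-definite square root.\<close>

definition psd_sqrt :: "real^'n^'n \<Rightarrow> real^'n^'n" where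
  "psd_sqrt M = (THE R. sym_psd R \<and> R ** R = M)"

definition grad :: "('a::real_inner \<Rightarrow> real) \<Rightarrow> 'a \<Rightarrow> 'a" where
  "grad f x = (THE D. GDERIV f x :> D)"

text \<open>A proper convex function with values in the reals extended by \<open>\<infinity>\<close>. With the convention
  \<open>0 * \<infinity> = 0\<close> of type \<open>ereal\<close>, the cases \<open>t = 0\<close> and \<open>t = 1\<close> of the inequality are trivial.\<close>

definition proper_convex :: "('a::real_vector \<Rightarrow> ereal) \<Rightarrow> bool" where
  "proper_convex h \<longleftrightarrow> (\<forall>x. h x \<noteq> -\<infinity>) \<and> (\<exists>x. h x \<noteq> \<infinity>) \<and>
     (\<forall>x y t. 0 \<le> t \<and> t \<le> 1 \<longrightarrow>
        h ((1 - t) *\<^sub>R x + t *\<^sub>R y) \<le> ereal (1 - t) * h x + ereal t * h y)"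

definition subdifferential :: "('a::real_inner \<Rightarrow> ereal) \<Rightarrow> 'a \<Rightarrow> 'a set" where
  "subdifferential h x =
     {p. \<bar>h x\<bar> \<noteq> \<infinity> \<and> (\<forall>u. h x + ereal (p \<bullet> (u - x)) \<le> h u)}"

definition conjugate :: "('a::real_inner \<Rightarrow> ereal) \<Rightarrow> 'a \<Rightarrow> ereal" where
  "conjugate h \<beta> = (SUP u. ereal (\<beta> \<bullet> u) - h u)"

text \<open>\<open>bregman h p u' u\<close> is the Bregman divergence \<open>D\<^sub>h(u', u)\<close>, with base point the first argument
  \<open>u'\<close>; \<open>p\<close> is the gradient or the chosen subgradient of \<open>h\<close> at \<open>u'\<close>.\<close>

definition bregman ::
  "('a::real_inner \<Rightarrow> ereal) \<Rightarrow> 'a \<Rightarrow> 'a \<Rightarrow> 'a \<Rightarrow> ereal" where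
  "bregman h p u' u = h u - h u' - ereal (p \<bullet> (u - u'))"

text \<open>\<open>smooth L f\<close>: \<open>f\<close> is \<open>L\<close>-smooth. It is used with \<open>L = 1 / \<gamma>\<close>.\<close>

definition smooth :: "real \<Rightarrow> ('a::real_inner \<Rightarrow> real) \<Rightarrow> bool" where
  "smooth L f \<longleftrightarrow> (\<forall>x. f differentiable (at x)) \<and>
     (\<forall>w w'. bregman (\<lambda>x. ereal (f x)) (grad f w') w' w \<le> ereal (L / 2 * (norm (w' - w))\<^sup>2))"

definition strongly_convex :: "real \<Rightarrow> ('a::real_inner \<Rightarrow> ereal) \<Rightarrow> bool" where
  "strongly_convex lam h \<longleftrightarrow>
     (\<forall>v v'. \<forall>p \<in> subdifferential h v'.
        bregman h p v' v \<ge> ereal (lam / 2 * (norm (v' - v))\<^sup>2))"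

definition quad_model ::
  "(real^'n \<Rightarrow> real) \<Rightarrow> real^'n^'n \<Rightarrow> real^'n \<Rightarrow> real^'n \<Rightarrow> real" where
  "quad_model \<phi> H w' w =
     \<phi> w' + grad \<phi> w' \<bullet> (w - w') + 1 / 2 * wnorm_sq H (w - w')"

text \<open>The sequences \<open>w\<close>, \<open>v\<close>, \<open>\<alpha>\<close>, with arbitrary values at index 0, are generated by preconditioned
  linearized ADMM. Minimizers need not be unique, so the updates of \<open>v\<close> and \<open>w\<close> are relations.\<close>

definition prec_lin_admm ::
  "(real^'n \<Rightarrow> real) \<Rightarrow> (real^'m \<Rightarrow> ereal) \<Rightarrow> real^'n^'n \<Rightarrow> real^'m^'n \<Rightarrow> real^'n \<Rightarrow> real \<Rightarrow>
   real^'m^'m \<Rightarrow> real^'n^'n \<Rightarrow> (nat \<Rightarrow> real^'n) \<Rightarrow> (nat \<Rightarrow> real^'m) \<Rightarrow> (nat \<Rightarrow> real^'n) \<Rightarrow> bool" where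
  "prec_lin_admm \<phi> g A B c \<rho> G H w v \<alpha> \<longleftrightarrow>
     (\<forall>t\<ge>1.
        is_arg_min
          (\<lambda>x. g x - ereal (\<alpha> (t - 1) \<bullet> (B *v x))
             + ereal (\<rho> / 2 * (norm (A *v w (t - 1) - B *v x - c))\<^sup>2)
             + ereal (\<rho> / 2 * wnorm_sq G (x - v (t - 1))))
          (\<lambda>_. True) (v t) \<and>
        is_arg_min
          (\<lambda>x. quad_model \<phi> H (w (t - 1)) x + \<alpha> (t - 1) \<bullet> (A *v x)
             + \<rho> / 2 * (norm (A *v x - B *v v t - c))\<^sup>2)
          (\<lambda>_. True) (w t) \<and>
        \<alpha> t = \<alpha> (t - 1) + \<rho> *\<^sub>R (A *v w t - B *v v t - c))"

text \<open>The fraction \<open>a / b\<close>, read as \<open>\<infinity>\<close> when the denominator vanishes.\<close>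

definition ext_frac :: "real \<Rightarrow> real \<Rightarrow> ereal" where
  "ext_frac a b = (if b = 0 then \<infinity> else ereal (a / b))"

end

theory Submission
  imports Defs
begin

text \<open>Write \<open>H'\<close> for \<open>Ht\<close>, and \<open>a\<close>, \<open>b\<close>, \<open>e\<close>, \<open>z\<close> for \<open>A (w - w\<^sub>*)\<close>, \<open>B (v - v\<^sub>*)\<close>,
  \<open>\<alpha> - \<alpha>\<^sub>*\<close>, \<open>v - v\<^sub>*\<close>; let \<open>w\<^sup>-\<close>, \<open>a\<^sup>-\<close> belong to the previous iterate. The optimality condition of
  the \<open>w\<close>-update says \<open>\<nabla>\<phi>(w\<^sup>-) = - A\<^sup>T (\<alpha> + H' A (w - w\<^sup>-))\<close>, so the divergences of \<open>\<phi>\<close> and of its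
  conjugate are the two halves of \<open>(\<nabla>\<phi>(w\<^sup>-) - \<nabla>\<phi>(w\<^sub>*)) \<bullet> (w\<^sup>- - w\<^sub>*)\<close>. Each of them is at most this
  inner product minus the co-coercivity lower bound on the other one, and since \<open>H\<close> dominates
  \<open>1 / \<gamma>\<close>, completing a square leaves a surplus \<open>\<bar>e\<bar>\<^sup>2 / (2 S)\<close>, where \<open>S\<close> is the largest eigenvalue
  of \<open>H'\<close>. Adding the strong convexity estimate for \<open>g\<close> telescopes to the weighted energy, with
  further surplus \<open>\<rho> / 2 \<bar>a\<^sup>- - b\<bar>\<^sup>2 + \<lambda> / 2 \<bar>z\<bar>\<^sup>2\<close>. A weighted Young inequality for
  \<open>a\<^sup>- = (a\<^sup>- - b) + b\<close> with weight \<open>(s + \<theta>) / (1 + \<theta>)\<close> shows that the surpluses pay for the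
  contraction of the energy by the factor \<open>1 + \<theta>\<close>.\<close>

section \<open>Extremal eigenvalues and singular values through Rayleigh quotients\<close>

text \<open>For negative \<open>a\<close> the linear term beats \<open>s\<^sup>2 * b\<close> once
  \<open>s\<close> is small. This replaces differentiation in the first-order optimality arguments
  below.\<close>

lemma nonneg_of_nonneg_perturbation:
  fixes a b :: real
  assumes "\<And>s. 0 < s \<Longrightarrow> s \<le> 1 \<Longrightarrow> 0 \<le> s * a + s\<^sup>2 * b"
  shows "0 \<le> a"
proof (rule ccontr)
  assume "\<not> 0 \<le> a"
  hence a: "a < 0" by simp
  define s where "s = - a / (\<bar>a\<bar> + \<bar>b\<bar> + 1)"
  have s: "0 < s" "s \<le> 1" using a by (auto simp: s_def field_simps)
  have "s * \<bar>b\<bar> < - a" using a by (auto simp: s_def field_simps mult_less_0_iff)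
  moreover have "s * b \<le> s * \<bar>b\<bar>" using s by (intro mult_left_mono) auto
  ultimately have "a + s * b < 0" by linarith
  hence "s * (a + s * b) < 0" using s by (simp add: mult_pos_neg)
  thus False using assms[OF s] by (simp add: power2_eq_square algebra_simps)
qed

lemma inner_transpose_mult: "(transpose M *v x) \<bullet> y = x \<bullet> (M *v (y :: real^'m))"
  by (simp add: transpose_matrix_vector dot_lmul_matrix)

lemma wnorm_sq_congruence: "wnorm_sq (transpose A ** M ** A) x = wnorm_sq M (A *v x)"
  using inner_transpose_mult[of A "M *v (A *v x)" x]
  by (simp add: wnorm_sq_def matrix_vector_mul_assoc[symmetric] inner_commute
      del: transpose_matrix_vector)

lemma symmetric_inner_commute:
  assumes "transpose M = M"
  shows "(M *v x) \<bullet> y = x \<bullet> (M *v (y :: real^'n))"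
  using inner_transpose_mult[of M x y] assms by simp

text \<open>By compactness the form has a maximizer \<open>u\<close> on the unit sphere. Then
  \<open>\<mu> * (norm x)\<^sup>2 - x \<bullet> (M *v x)\<close> is nonnegative and vanishes at
  \<open>u\<close>, so its first variation at \<open>u\<close> is zero, which is the eigenvalue
  equation.\<close>

lemma rayleigh_maximum_is_eigenvalue:
  fixes M :: "real^'n^'n"
  assumes sym: "transpose M = M"
  obtains \<mu> where "\<mu> \<in> eigenvalues M" "\<And>x. x \<bullet> (M *v x) \<le> \<mu> * (norm x)\<^sup>2"
proof -
  have "continuous_on (sphere 0 1) (\<lambda>x. x \<bullet> (M *v x))"
    by (intro continuous_intros matrix_vector_mult_linear_continuous_on)
  moreover obtain b :: "real^'n" where "b \<in> Basis"
    using nonempty_Basis by blast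
  hence "sphere (0 :: real^'n) 1 \<noteq> {}" by (auto intro!: exI[of _ b])
  ultimately obtain u :: "real^'n" where u: "norm u = 1"
    and umax: "\<And>x. norm x = 1 \<Longrightarrow> x \<bullet> (M *v x) \<le> u \<bullet> (M *v u)"
    using continuous_attains_sup[OF compact_sphere, of 0 1 "\<lambda>x. x \<bullet> (M *v x)"] by auto
  define \<mu> where "\<mu> = u \<bullet> (M *v u)"
  have bound: "x \<bullet> (M *v x) \<le> \<mu> * (norm x)\<^sup>2" for x
  proof (cases "x = 0")
    case False
    have "(x /\<^sub>R norm x) \<bullet> (M *v (x /\<^sub>R norm x)) \<le> \<mu>"
      unfolding \<mu>_def by (rule umax) (use False in simp)
    thus ?thesis using False
      by (simp add: matrix_vector_mult_scaleR field_simps power2_eq_square)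
  qed simp
  \<comment> \<open>The residual of the eigenvalue equation. Moving from \<open>u\<close> along
    \<open>- r\<close> changes the nonnegative form by \<open>- 2 * s * (norm r)\<^sup>2\<close> to
    first order, which forces \<open>r = 0\<close>.\<close>
  define r where "r = \<mu> *\<^sub>R u - M *v u"
  define b where "b = \<mu> * (norm r)\<^sup>2 - r \<bullet> (M *v r)"
  have "0 \<le> s * (- 2 * (norm r)\<^sup>2) + s\<^sup>2 * b" for s
  proof -
    have "0 \<le> \<mu> * (norm (u - s *\<^sub>R r))\<^sup>2 - (u - s *\<^sub>R r) \<bullet> (M *v (u - s *\<^sub>R r))"
      using bound by simp
    also have "\<dots> = \<mu> * (norm u)\<^sup>2 - u \<bullet> (M *v u) + s * (- 2 * (r \<bullet> (\<mu> *\<^sub>R u - M *v u))) + s\<^sup>2 * b"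
      using symmetric_inner_commute[OF sym, of u r]
      unfolding b_def power2_norm_eq_inner
      by (simp add: matrix_vector_mult_scaleR matrix_vector_mult_diff_distrib inner_diff_left
          inner_diff_right inner_commute algebra_simps power2_eq_square)
    finally show ?thesis
      unfolding r_def[symmetric] using u by (simp add: \<mu>_def power2_norm_eq_inner)
  qed
  hence "0 \<le> - 2 * (norm r)\<^sup>2" by (rule nonneg_of_nonneg_perturbation)
  hence "r = 0" by simp
  hence "M *v u = \<mu> *\<^sub>R u" by (simp add: r_def)
  moreover have "u \<noteq> 0" using u by auto
  ultimately have "\<mu> \<in> eigenvalues M" unfolding eigenvalues_def by blast
  thus thesis using bound that by blast
qed

text \<open>Eigenvectors of distinct eigenvalues are orthogonal, so one eigenvector per eigenvalue
  gives an independent set.\<close>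

lemma finite_eigenvalues_symmetric:
  fixes M :: "real^'n^'n"
  assumes sym: "transpose M = M"
  shows "finite (eigenvalues M)"
proof -
  have "\<forall>\<mu>\<in>eigenvalues M. \<exists>x. x \<noteq> 0 \<and> M *v x = \<mu> *\<^sub>R x"
    by (simp add: eigenvalues_def)
  then obtain f where f: "\<And>\<mu>. \<mu> \<in> eigenvalues M \<Longrightarrow> f \<mu> \<noteq> 0 \<and> M *v f \<mu> = \<mu> *\<^sub>R f \<mu>"
    by (meson bchoice)
  have orth: "f \<mu> \<bullet> f \<nu> = 0" if "\<mu> \<in> eigenvalues M" "\<nu> \<in> eigenvalues M" "\<mu> \<noteq> \<nu>" for \<mu> \<nu>
    using symmetric_inner_commute[OF sym, of "f \<mu>" "f \<nu>"] f that by auto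
  have "inj_on f (eigenvalues M)"
    using orth f by (auto simp: inj_on_def) (metis inner_eq_zero_iff)
  moreover have "independent (f ` eigenvalues M)"
    using f orth
    by (intro pairwise_orthogonal_independent)
      (auto simp: pairwise_def orthogonal_def)
  ultimately show ?thesis
    using independent_imp_finite finite_imageD by blast
qed

lemma inner_le_max_eigenvalue:
  fixes M :: "real^'n^'n"
  assumes "transpose M = M"
  shows "x \<bullet> (M *v x) \<le> max_eigenvalue M * (norm x)\<^sup>2"
proof -
  obtain \<mu> where \<mu>: "\<mu> \<in> eigenvalues M" "\<And>x. x \<bullet> (M *v x) \<le> \<mu> * (norm x)\<^sup>2"
    using rayleigh_maximum_is_eigenvalue[OF assms] by blast
  have "\<mu> \<le> max_eigenvalue M"
    unfolding max_eigenvalue_def using \<mu>(1) finite_eigenvalues_symmetric[OF assms] by simp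
  hence "\<mu> * (norm x)\<^sup>2 \<le> max_eigenvalue M * (norm x)\<^sup>2" by (intro mult_right_mono) auto
  with \<mu>(2) show ?thesis using order_trans by blast
qed

text \<open>The Rayleigh maximum of \<open>- M\<close> is the negative of an eigenvalue of
  \<open>M\<close>.\<close>

lemma min_eigenvalue_le_inner:
  fixes M :: "real^'n^'n"
  assumes "transpose M = M"
  shows "min_eigenvalue M * (norm x)\<^sup>2 \<le> x \<bullet> (M *v x)"
proof -
  have neg: "(- M) *v y = - (M *v y)" for y
    using matrix_vector_mult_diff_rdistrib[of 0 M y] by simp
  have "transpose (- M) = - M" using assms by (simp add: transpose_def vec_eq_iff)
  then obtain \<mu> where \<mu>: "\<mu> \<in> eigenvalues (- M)" "\<And>x. x \<bullet> ((- M) *v x) \<le> \<mu> * (norm x)\<^sup>2"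
    using rayleigh_maximum_is_eigenvalue by blast
  have "- \<mu> \<in> eigenvalues M" using \<mu>(1) unfolding eigenvalues_def neg
    by (auto simp: minus_equation_iff[of "M *v _"])
  hence "min_eigenvalue M \<le> - \<mu>"
    unfolding min_eigenvalue_def using finite_eigenvalues_symmetric[OF assms] by simp
  hence "min_eigenvalue M * (norm x)\<^sup>2 \<le> - \<mu> * (norm x)\<^sup>2" by (intro mult_right_mono) auto
  with \<mu>(2)[of x] show ?thesis by (simp add: neg)
qed

text \<open>The quadratic form of \<open>transpose M ** M\<close> is
  \<open>(norm (M *v x))\<^sup>2\<close>, so its Rayleigh maximum is nonnegative and the square root
  of that maximum is a singular value bounding the norm of \<open>M\<close>.\<close>

lemma
  fixes M :: "real^'m^'n"
  shows max_singular_value_nonneg: "0 \<le> max_singular_value M"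
    and norm_mult_le_max_singular_value: "norm (M *v x) \<le> max_singular_value M * norm x"
proof -
  have sym: "transpose (transpose M ** M) = transpose M ** M"
    by (simp add: matrix_transpose_mul)
  have quad: "y \<bullet> ((transpose M ** M) *v y) = (norm (M *v y))\<^sup>2" for y
    using inner_transpose_mult[of M "M *v y" y]
    by (simp add: matrix_vector_mul_assoc[symmetric] inner_commute power2_norm_eq_inner)
  obtain \<mu> where \<mu>: "\<mu> \<in> eigenvalues (transpose M ** M)"
    "\<And>x. x \<bullet> ((transpose M ** M) *v x) \<le> \<mu> * (norm x)\<^sup>2"
    using rayleigh_maximum_is_eigenvalue[OF sym] by blast
  from \<mu>(1) obtain y where y: "y \<noteq> 0" "(transpose M ** M) *v y = \<mu> *\<^sub>R y"
    unfolding eigenvalues_def by blast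
  have "\<mu> * (norm y)\<^sup>2 = (norm (M *v y))\<^sup>2"
    using quad[of y] y(2) by (simp add: power2_norm_eq_inner)
  hence "0 \<le> \<mu> * (norm y)\<^sup>2" by simp
  with y(1) have \<mu>0: "0 \<le> \<mu>" by (simp add: zero_le_mult_iff)
  have le: "sqrt \<mu> \<le> max_singular_value M"
    unfolding max_singular_value_def singular_values_def
    using \<mu>(1) finite_eigenvalues_symmetric[OF sym] by simp
  thus "0 \<le> max_singular_value M" using \<mu>0 by (meson order_trans real_sqrt_ge_zero)
  have "(norm (M *v x))\<^sup>2 \<le> (sqrt \<mu> * norm x)\<^sup>2"
    using \<mu>(2)[of x] \<mu>0 unfolding quad by (simp add: power_mult_distrib)
  hence "norm (M *v x) \<le> sqrt \<mu> * norm x" by (rule power2_le_imp_le) (simp add: \<mu>0)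
  also have "\<dots> \<le> max_singular_value M * norm x" using le by (intro mult_right_mono) auto
  finally show "norm (M *v x) \<le> max_singular_value M * norm x" .
qed

text \<open>Semi-definiteness is applied at \<open>x - k *\<^sub>R (M *v x)\<close> with
  \<open>k = 1 / max_eigenvalue M\<close>, for which the quadratic term of the expansion is at most
  half the size of the linear one.\<close>

lemma psd_norm_mult_sq_le:
  fixes M :: "real^'n^'n"
  assumes "sym_psd M" and \<sigma>: "0 < max_eigenvalue M"
  shows "(norm (M *v x))\<^sup>2 / max_eigenvalue M \<le> x \<bullet> (M *v x)"
proof -
  have sym: "transpose M = M" and psd: "\<And>x. 0 \<le> x \<bullet> (M *v x)"
    using assms(1) by (auto simp: sym_psd_def)
  define k where "k = 1 / max_eigenvalue M"
  define y where "y = M *v x"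
  have k: "0 < k" "k * max_eigenvalue M = 1" using \<sigma> by (auto simp: k_def)
  have "0 \<le> (x - k *\<^sub>R y) \<bullet> (M *v (x - k *\<^sub>R y))" by (rule psd)
  also have "\<dots> = x \<bullet> (M *v x) - 2 * k * (norm y)\<^sup>2 + k\<^sup>2 * (y \<bullet> (M *v y))"
    using symmetric_inner_commute[OF sym, of x y]
    unfolding y_def[symmetric] power2_norm_eq_inner
    by (simp add: matrix_vector_mult_scaleR matrix_vector_mult_diff_distrib inner_diff_left
        inner_diff_right inner_commute algebra_simps power2_eq_square
        y_def[symmetric])
  also have "k\<^sup>2 * (y \<bullet> (M *v y)) \<le> k\<^sup>2 * (max_eigenvalue M * (norm y)\<^sup>2)"
    by (intro mult_left_mono inner_le_max_eigenvalue[OF sym]) simp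
  also have "\<dots> = k * (norm y)\<^sup>2" using k(2) by (simp add: power2_eq_square algebra_simps)
  finally show ?thesis using k by (simp add: y_def k_def)
qed

section \<open>Gradients, tangents and conjugates of smooth convex functions\<close>

text \<open>As \<open>grad\<close> is a definite description, both existence and uniqueness are
  required: the Riesz vector of the derivative comes from its adjoint, and derivatives are
  unique.\<close>

lemma GDERIV_grad:
  fixes f :: "'a::euclidean_space \<Rightarrow> real"
  assumes "f differentiable (at x)"
  shows "GDERIV f x :> grad f x"
proof -
  obtain f' where f': "(f has_derivative f') (at x)"
    using assms unfolding differentiable_def by blast
  define D where "D = adjoint f' 1"
  have D: "f' h = h \<bullet> D" for h
    using adjoint_works[OF has_derivative_linear[OF f'], of h 1] by (simp add: D_def)
  hence "f' = (\<lambda>h. h \<bullet> D)" by blast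
  with f' have g: "GDERIV f x :> D" by (simp add: gderiv_def)
  have "E = D" if "GDERIV f x :> E" for E
  proof -
    have "(\<lambda>h. h \<bullet> E) = (\<lambda>h. h \<bullet> D)"
      using that g unfolding gderiv_def by (rule has_derivative_unique)
    thus ?thesis by (metis vector_eq_rdot inner_commute vector_eq_ldot)
  qed
  with g show ?thesis unfolding grad_def by (metis theI)
qed

text \<open>Restricting \<open>f\<close> to the line through \<open>x\<close> and \<open>y\<close>
  reduces this to one real variable.\<close>

lemma convex_above_tangent:
  fixes f :: "'a::euclidean_space \<Rightarrow> real"
  assumes "convex_on UNIV f" "f differentiable (at x)"
  shows "f x + grad f x \<bullet> (y - x) \<le> f y"
proof -
  define k where "k s = f (x + s *\<^sub>R (y - x))" for s :: real
  have "convex_on UNIV k"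
  proof (intro convex_onI)
    fix t a b :: real assume t: "0 < t" "t < 1"
    have "x + ((1 - t) * a + t * b) *\<^sub>R (y - x)
        = (1 - t) *\<^sub>R (x + a *\<^sub>R (y - x)) + t *\<^sub>R (x + b *\<^sub>R (y - x))"
      by (simp add: algebra_simps)
    thus "k ((1 - t) *\<^sub>R a + t *\<^sub>R b) \<le> (1 - t) * k a + t * k b"
      using convex_onD[OF assms(1), of t "x + a *\<^sub>R (y - x)" "x + b *\<^sub>R (y - x)"] t
      by (simp add: k_def)
  qed simp
  moreover have "(k has_real_derivative (grad f x \<bullet> (y - x))) (at 0)"
  proof -
    have "(f has_derivative (\<lambda>h. h \<bullet> grad f x)) (at (x + 0 *\<^sub>R (y - x)))"
      using GDERIV_grad[OF assms(2)] by (simp add: gderiv_def)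
    moreover have "((\<lambda>s. x + s *\<^sub>R (y - x)) has_derivative (\<lambda>s. s *\<^sub>R (y - x))) (at 0)"
      by (auto intro!: derivative_eq_intros)
    ultimately have "(k has_derivative (\<lambda>s. (s *\<^sub>R (y - x)) \<bullet> grad f x)) (at 0)"
      unfolding k_def by (rule has_derivative_compose[rotated])
    thus ?thesis
      unfolding has_field_derivative_def
      by (simp add: inner_commute mult.commute[of _ "grad f x \<bullet> _"] )
  qed
  ultimately have "k 1 - k 0 \<ge> (grad f x \<bullet> (y - x)) * (1 - 0)"
    by (intro convex_on_imp_above_tangent[of UNIV]) auto
  thus ?thesis by (simp add: k_def)
qed

lemma smooth_upper_bound:
  assumes "smooth L f"
  shows "f w \<le> f w' + grad f w' \<bullet> (w - w') + L / 2 * (norm (w' - w))\<^sup>2"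
proof -
  have "bregman (\<lambda>x. ereal (f x)) (grad f w') w' w \<le> ereal (L / 2 * (norm (w' - w))\<^sup>2)"
    using assms by (simp add: smooth_def)
  thus ?thesis by (simp add: bregman_def)
qed

text \<open>Co-coercivity. At \<open>u = x - \<gamma> *\<^sub>R d\<close> the value
  \<open>f u\<close> lies above the tangent at \<open>y\<close> and below the quadratic upper model
  at \<open>x\<close>; this \<open>u\<close> minimizes the gap between the two bounds.\<close>

lemma bregman_ge_norm_grad_diff:
  fixes f :: "'a::euclidean_space \<Rightarrow> real"
  assumes \<gamma>: "0 < \<gamma>" and "convex_on UNIV f" and "smooth (1 / \<gamma>) f"
  shows "\<gamma> / 2 * (norm (grad f x - grad f y))\<^sup>2 \<le> f x - f y - grad f y \<bullet> (x - y)"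
proof -
  define d where "d = grad f x - grad f y"
  define u where "u = x - \<gamma> *\<^sub>R d"
  have diff: "f differentiable (at y)" using assms(3) by (simp add: smooth_def)
  have "f y + grad f y \<bullet> (u - y) \<le> f u"
    by (rule convex_above_tangent[OF assms(2) diff])
  also have "f u \<le> f x + grad f x \<bullet> (u - x) + (1 / \<gamma>) / 2 * (norm (x - u))\<^sup>2"
    by (rule smooth_upper_bound[OF assms(3)])
  also have "(1 / \<gamma>) / 2 * (norm (x - u))\<^sup>2 = \<gamma> / 2 * (norm d)\<^sup>2"
    using \<gamma> by (simp add: u_def power_mult_distrib power2_eq_square field_simps)
  finally have "f y + grad f y \<bullet> (x - y) + \<gamma> * (d \<bullet> d) - \<gamma> / 2 * (norm d)\<^sup>2 \<le> f x"
    by (simp add: u_def d_def inner_diff_left inner_diff_right inner_commute algebra_simps)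
  thus ?thesis
    unfolding d_def[symmetric] by (simp add: power2_norm_eq_inner)
qed

text \<open>Equality in Fenchel-Young: by the tangent inequality the supremum is attained at
  \<open>x\<close>. Hence a divergence of the conjugate between two gradients becomes a divergence
  of \<open>f\<close> with the points swapped.\<close>

lemma conjugate_at_grad:
  fixes f :: "'a::euclidean_space \<Rightarrow> real"
  assumes "convex_on UNIV f" "f differentiable (at x)"
  shows "conjugate (\<lambda>x. ereal (f x)) (grad f x) = ereal (grad f x \<bullet> x - f x)"
  unfolding conjugate_def
proof (rule antisym)
  show "(SUP u. ereal (grad f x \<bullet> u) - ereal (f u)) \<le> ereal (grad f x \<bullet> x - f x)"
  proof (rule SUP_least)
    fix u
    show "ereal (grad f x \<bullet> u) - ereal (f u) \<le> ereal (grad f x \<bullet> x - f x)"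
      using convex_above_tangent[OF assms, of u] by (simp add: inner_diff_right)
  qed
  show "ereal (grad f x \<bullet> x - f x) \<le> (SUP u. ereal (grad f x \<bullet> u) - ereal (f u))"
    by (rule SUP_upper2[of x]) auto
qed

section \<open>Optimality conditions of the two minimization steps\<close>

text \<open>The vector \<open>p\<close> acts as the gradient of \<open>q\<close> at
  \<open>v\<close>. Comparing \<open>v\<close> with the points of the segment towards
  \<open>u\<close>, where convexity bounds \<open>h\<close> by interpolation, gives a nonnegative
  expression in \<open>s\<close> whose linear coefficient is the subgradient inequality.\<close>

lemma argmin_add_quadratic_subgradient:
  fixes h :: "'a::real_inner \<Rightarrow> ereal" and q C :: "'a \<Rightarrow> real"
  assumes h: "proper_convex h"
    and min: "is_arg_min (\<lambda>x. h x + ereal (q x)) (\<lambda>_. True) v"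
    and q: "\<And>d s. q (v + s *\<^sub>R d) = q v + s * (p \<bullet> d) + s\<^sup>2 * C d"
  shows "- p \<in> subdifferential h v"
proof -
  have le: "h v + ereal (q v) \<le> h u + ereal (q u)" for u
    using min by (auto simp: is_arg_min_def not_less)
  \<comment> \<open>Comparison with a point of finite value makes \<open>h v\<close> finite, as
    membership in the subdifferential demands.\<close>
  obtain x0 where "h x0 \<noteq> \<infinity>" using h by (auto simp: proper_convex_def)
  with le[of x0] have "h v \<noteq> \<infinity>" by auto
  then obtain hv where hv: "h v = ereal hv"
    using h by (cases "h v") (auto simp: proper_convex_def)
  have "h v + ereal (- p \<bullet> (u - v)) \<le> h u" for u
  proof (cases "h u")
    case (real hu)
    have "0 \<le> hu - hv + p \<bullet> (u - v)"
    proof (rule nonneg_of_nonneg_perturbation)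
      fix s :: real assume s: "0 < s" "s \<le> 1"
      have eq: "(1 - s) *\<^sub>R v + s *\<^sub>R u = v + s *\<^sub>R (u - v)" by (simp add: algebra_simps)
      have conv: "h (v + s *\<^sub>R (u - v)) \<le> ereal ((1 - s) * hv + s * hu)"
        using h s hv real unfolding proper_convex_def eq[symmetric]
        by (metis less_imp_le plus_ereal.simps(1) times_ereal.simps(1))
      have "h v + ereal (q v) \<le> h (v + s *\<^sub>R (u - v)) + ereal (q (v + s *\<^sub>R (u - v)))"
        by (rule le)
      also have "\<dots> \<le> ereal ((1 - s) * hv + s * hu) + ereal (q (v + s *\<^sub>R (u - v)))"
        by (intro add_right_mono conv)
      finally show "0 \<le> s * (hu - hv + p \<bullet> (u - v)) + s\<^sup>2 * C (u - v)"
        unfolding hv q by (simp add: algebra_simps)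
    qed
    thus ?thesis by (simp add: hv real)
  next
    case MInf
    thus ?thesis using h by (auto simp: proper_convex_def)
  qed auto
  thus ?thesis by (simp add: subdifferential_def hv)
qed

lemma admm_v_update_subgradient:
  fixes A :: "real^'n^'n" and B :: "real^'m^'n"
  assumes admm: "prec_lin_admm \<phi> g A B c \<rho> G H w v \<alpha>" and t: "1 \<le> t"
    and g: "proper_convex g" and G: "transpose G = G"
  shows "transpose B *v (\<alpha> t - \<rho> *\<^sub>R (A *v (w t - w (t - 1)))) - \<rho> *\<^sub>R (G *v (v t - v (t - 1)))
    \<in> subdifferential g (v t)"
proof -
  define r where "r = A *v w (t - 1) - B *v v t - c"
  define z where "z = v t - v (t - 1)"
  define q where "q x = - (\<alpha> (t - 1) \<bullet> (B *v x))
      + \<rho> / 2 * (norm (A *v w (t - 1) - B *v x - c))\<^sup>2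
      + \<rho> / 2 * wnorm_sq G (x - v (t - 1))" for x
  \<comment> \<open>The gradient at \<open>v t\<close> of the quadratic part \<open>q\<close> of the
    objective.\<close>
  define p where "p = - (transpose B *v \<alpha> (t - 1)) - \<rho> *\<^sub>R (transpose B *v r) + \<rho> *\<^sub>R (G *v z)"
  have "is_arg_min (\<lambda>x. g x - ereal (\<alpha> (t - 1) \<bullet> (B *v x))
             + ereal (\<rho> / 2 * (norm (A *v w (t - 1) - B *v x - c))\<^sup>2)
             + ereal (\<rho> / 2 * wnorm_sq G (x - v (t - 1)))) (\<lambda>_. True) (v t)"
    using admm t by (simp add: prec_lin_admm_def)
  moreover have "g x - ereal (\<alpha> (t - 1) \<bullet> (B *v x))
             + ereal (\<rho> / 2 * (norm (A *v w (t - 1) - B *v x - c))\<^sup>2)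
             + ereal (\<rho> / 2 * wnorm_sq G (x - v (t - 1))) = g x + ereal (q x)" for x
    by (cases "g x") (simp_all add: q_def)
  ultimately have min: "is_arg_min (\<lambda>x. g x + ereal (q x)) (\<lambda>_. True) (v t)" by simp
  have expand: "q (v t + s *\<^sub>R d) = q (v t) + s * (p \<bullet> d)
      + s\<^sup>2 * (\<rho> / 2 * (norm (B *v d))\<^sup>2 + \<rho> / 2 * wnorm_sq G d)" for s d
  proof -
    have r': "A *v w (t - 1) - B *v (v t + s *\<^sub>R d) - c = r - s *\<^sub>R (B *v d)"
      by (simp add: r_def matrix_vector_right_distrib matrix_vector_mult_scaleR)
    have z': "v t + s *\<^sub>R d - v (t - 1) = z + s *\<^sub>R d" by (simp add: z_def)
    have "d \<bullet> (G *v z) = z \<bullet> (G *v d)"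
      using symmetric_inner_commute[OF G, of z d] by (simp add: inner_commute)
    thus ?thesis
      unfolding q_def r' z' p_def r_def[symmetric] z_def[symmetric] wnorm_sq_def
        power2_norm_eq_inner
      by (simp add: dot_lmul_matrix symmetric_inner_commute[OF G]
          matrix_vector_right_distrib matrix_vector_mult_scaleR inner_simps
          inner_commute[of "B *v d" r] power2_eq_square algebra_simps)
  qed
  have "- p \<in> subdifferential g (v t)"
    by (rule argmin_add_quadratic_subgradient[OF g min expand])
  \<comment> \<open>The \<open>v\<close>-update sees \<open>w (t - 1)\<close> while the dual update
    sees \<open>w t\<close>; the difference is the correction term
    \<open>\<rho> *\<^sub>R (A *v (w t - w (t - 1)))\<close>.\<close>
  moreover have "\<alpha> (t - 1) + \<rho> *\<^sub>R r = \<alpha> t - \<rho> *\<^sub>R (A *v (w t - w (t - 1)))"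
    using admm t
    by (simp add: prec_lin_admm_def r_def matrix_vector_mult_diff_distrib algebra_simps)
  hence "- p = transpose B *v (\<alpha> t - \<rho> *\<^sub>R (A *v (w t - w (t - 1)))) - \<rho> *\<^sub>R (G *v z)"
    unfolding p_def
    by (metis (no_types, lifting) add_uminus_conv_diff matrix_vector_mult_scaleR
        matrix_vector_right_distrib minus_add_distrib minus_diff_eq uminus_add_conv_diff
        diff_minus_eq_add add.commute)
  ultimately show ?thesis by (simp add: z_def)
qed

text \<open>The objective is real-valued, so the optimality lemma is applied with the zero function
  as \<open>h\<close>. The dual update absorbs the penalty term, and the factorization of
  \<open>H\<close> brings out \<open>transpose A\<close>.\<close>

lemma admm_w_update_stationary:
  fixes A Ht :: "real^'n^'n" and B :: "real^'m^'n"
  assumes admm: "prec_lin_admm \<phi> g A B c \<rho> G H w v \<alpha>" and t: "1 \<le> t"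
    and H: "transpose H = H" and HA: "H = transpose A ** Ht ** A"
  shows "grad \<phi> (w (t - 1)) = - (transpose A *v (\<alpha> t + Ht *v (A *v (w t - w (t - 1)))))"
proof -
  define r where "r = A *v w t - B *v v t - c"
  define z where "z = w t - w (t - 1)"
  define q where "q x = quad_model \<phi> H (w (t - 1)) x + \<alpha> (t - 1) \<bullet> (A *v x)
             + \<rho> / 2 * (norm (A *v x - B *v v t - c))\<^sup>2" for x
  define p where "p = grad \<phi> (w (t - 1)) + H *v z + transpose A *v \<alpha> (t - 1)
    + \<rho> *\<^sub>R (transpose A *v r)"
  have pc: "proper_convex (\<lambda>_ :: real^'n. 0)" by (auto simp: proper_convex_def)
  have "is_arg_min q (\<lambda>_. True) (w t)"
    using admm t unfolding prec_lin_admm_def q_def by blast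
  hence min: "is_arg_min (\<lambda>x. 0 + ereal (q x)) (\<lambda>_. True) (w t)"
    by (simp add: is_arg_min_def)
  have expand: "q (w t + s *\<^sub>R d) = q (w t) + s * (p \<bullet> d)
      + s\<^sup>2 * (\<rho> / 2 * (norm (A *v d))\<^sup>2 + 1 / 2 * wnorm_sq H d)" for s d
  proof -
    have r': "A *v (w t + s *\<^sub>R d) - B *v v t - c = r + s *\<^sub>R (A *v d)"
      by (simp add: r_def matrix_vector_right_distrib matrix_vector_mult_scaleR)
    have z': "w t + s *\<^sub>R d - w (t - 1) = z + s *\<^sub>R d" by (simp add: z_def)
    have "d \<bullet> (H *v z) = z \<bullet> (H *v d)"
      using symmetric_inner_commute[OF H, of z d] by (simp add: inner_commute)
    thus ?thesis
      unfolding q_def quad_model_def r' z' p_def r_def[symmetric] z_def[symmetric] wnorm_sq_def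
        power2_norm_eq_inner
      by (simp add: dot_lmul_matrix symmetric_inner_commute[OF H]
          matrix_vector_right_distrib matrix_vector_mult_scaleR inner_simps
          inner_commute[of "A *v d" r] power2_eq_square algebra_simps)
  qed
  have "- p \<in> subdifferential (\<lambda>_. 0) (w t)"
    by (rule argmin_add_quadratic_subgradient[OF pc min expand])
  \<comment> \<open>The subgradient inequality of the zero function, tested at
    \<open>w t - p\<close>, forces \<open>p = 0\<close>.\<close>
  hence "0 + ereal (- p \<bullet> ((w t - p) - w t)) \<le> 0" unfolding subdifferential_def by blast
  hence "p \<bullet> p \<le> 0" by simp
  hence "p = 0" by (metis inner_ge_zero inner_eq_zero_iff order_antisym)
  moreover have "\<alpha> t = \<alpha> (t - 1) + \<rho> *\<^sub>R r"
    using admm t by (simp add: prec_lin_admm_def r_def)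
  moreover have "H *v z = transpose A *v (Ht *v (A *v z))"
    by (simp only: HA matrix_vector_mul_assoc matrix_mul_assoc)
  ultimately show ?thesis
    unfolding p_def z_def[symmetric]
    by (simp add: matrix_vector_right_distrib matrix_vector_mult_scaleR algebra_simps
        eq_neg_iff_add_eq_0)
qed

section \<open>Step-size bounds and telescoping\<close>

text \<open>The product form also covers a vanishing denominator, where it says
  \<open>0 \<le> a\<close>.\<close>

lemma le_ext_frac:
  assumes "ereal \<theta> \<le> ext_frac a b" "0 \<le> a" "0 \<le> b"
  shows "\<theta> * b \<le> a"
  using assms by (auto simp: ext_frac_def field_simps split: if_splits)

text \<open>Passing from \<open>T\<close> to \<open>Suc T\<close> divides all earlier weights by
  \<open>q\<close>, and the step inequality divided by \<open>q\<close> supplies the new term with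
  weight one.\<close>

lemma telescope_linear_rate:
  fixes d P :: "nat \<Rightarrow> real"
  assumes q: "0 < q" and step: "\<And>t. 1 \<le> t \<Longrightarrow> q * (d t + P t) \<le> P (t - 1)"
  shows "(\<Sum>t = 1..T. q powi (int t - int T) * d t) + P T \<le> q powi (- int T) * P 0"
proof (induction T)
  case (Suc T)
  have pw: "q powi (k - int (Suc T)) = q powi (k - int T) / q" for k
    using q by (simp add: power_int_diff power_int_add field_simps)
  have "(\<Sum>t = 1..Suc T. q powi (int t - int (Suc T)) * d t) + P (Suc T)
      = (\<Sum>t = 1..T. q powi (int t - int T) * d t) / q + (d (Suc T) + P (Suc T))"
    using q by (simp del: of_nat_Suc add: pw sum_divide_distrib) (simp add: power_int_add)
  also have "d (Suc T) + P (Suc T) \<le> P T / q"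
    using step[of "Suc T"] q by (simp add: field_simps)
  also have "(\<Sum>t = 1..T. q powi (int t - int T) * d t) / q + P T / q
      \<le> q powi (- int T) * P 0 / q"
    using Suc q by (simp add: add_divide_distrib[symmetric] divide_right_mono)
  also have "\<dots> = q powi (- int (Suc T)) * P 0"
    using pw[of 0] by simp
  finally show ?case by simp
qed simp


section \<open>Estimates for a single iteration\<close>

lemma max_eigenvalue_pos:
  fixes A H Ht :: "real^'n^'n"
  assumes HA: "H = transpose A ** Ht ** A" and Ht: "transpose Ht = Ht" and H: "transpose H = H"
    and pos: "0 < min_eigenvalue H"
  shows "0 < max_eigenvalue Ht"
proof -
  obtain x :: "real^'n" where x: "norm x = 1" using vector_choose_size[of 1] by auto
  have "0 < min_eigenvalue H * (norm x)\<^sup>2" using pos x by simp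
  also have "\<dots> \<le> x \<bullet> (H *v x)" by (rule min_eigenvalue_le_inner[OF H])
  also have "\<dots> = (A *v x) \<bullet> (Ht *v (A *v x))"
    using wnorm_sq_congruence[of A Ht x] by (simp add: wnorm_sq_def HA)
  also have "\<dots> \<le> max_eigenvalue Ht * (norm (A *v x))\<^sup>2" by (rule inner_le_max_eigenvalue[OF Ht])
  finally show ?thesis by (simp add: zero_less_mult_iff)
qed

text \<open>Here \<open>x\<close> and \<open>y\<close> are consecutive \<open>w\<close>-iterates.
  The two left-hand sides add up to \<open>\<Delta> \<bullet> (x - ws)\<close>, and each is at least
  \<open>\<gamma> / 2 * (norm \<Delta>)\<^sup>2\<close>, so it suffices to bound the sum minus that
  quantity by \<open>R\<close>.\<close>

lemma bregman_le_H_energy: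
  fixes A H Ht :: "real^'n^'n" and \<phi> :: "real^'n \<Rightarrow> real"
  assumes \<gamma>: "0 < \<gamma>" and conv: "convex_on UNIV \<phi>" and smooth: "smooth (1 / \<gamma>) \<phi>"
    and A: "invertible A" and H: "transpose H = H" and Ht: "sym_psd Ht"
    and HA: "H = transpose A ** Ht ** A" and min: "1 / \<gamma> \<le> min_eigenvalue H"
    and gx: "grad \<phi> x = - (transpose A *v (\<alpha> + Ht *v (A *v (y - x))))"
    and gs: "grad \<phi> ws = - (transpose A *v \<alpha>s)"
  defines "R \<equiv> - ((\<alpha> - \<alpha>s) \<bullet> (A *v (y - ws))) + (wnorm_sq H (x - ws) - wnorm_sq H (y - ws)) / 2
    - (norm (\<alpha> - \<alpha>s))\<^sup>2 / (2 * max_eigenvalue Ht)"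
  shows "\<phi> x - \<phi> ws - grad \<phi> ws \<bullet> (x - ws) \<le> R"
    and "\<phi> ws - \<phi> x - grad \<phi> x \<bullet> (ws - x) \<le> R"
proof -
  define \<delta> where "\<delta> = y - x"
  define e where "e = \<alpha> - \<alpha>s"
  define \<Delta> where "\<Delta> = grad \<phi> x - grad \<phi> ws"
  have Ht': "transpose Ht = Ht" using Ht by (simp add: sym_psd_def)
  have minpos: "0 < min_eigenvalue H" using \<gamma> min by (meson less_le_trans zero_less_divide_1_iff)
  have \<sigma>: "0 < max_eigenvalue Ht" by (rule max_eigenvalue_pos[OF HA Ht' H minpos])
  have coercive: "(norm u)\<^sup>2 \<le> \<gamma> * (u \<bullet> (H *v u))" for u
  proof -
    have "1 / \<gamma> * (norm u)\<^sup>2 \<le> min_eigenvalue H * (norm u)\<^sup>2"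
      using min by (intro mult_right_mono) auto
    also have "\<dots> \<le> u \<bullet> (H *v u)" by (rule min_eigenvalue_le_inner[OF H])
    finally show ?thesis using \<gamma> by (simp add: field_simps)
  qed
  have "inj ((*v) H)"
  proof (rule injI)
    fix a b assume "H *v a = H *v b"
    hence "H *v (a - b) = 0" by (simp add: matrix_vector_mult_diff_distrib)
    with coercive[of "a - b"] show "a = b" by simp
  qed
  hence "surj ((*v) H)" by (intro linear_injective_imp_surjective) auto
  \<comment> \<open>The preimage of \<open>\<Delta>\<close> under \<open>H\<close> serves to
    complete the square: \<open>u \<bullet> \<Delta>\<close> is the squared norm of
    \<open>\<Delta>\<close> in the inverse of \<open>H\<close>, hence at most
    \<open>\<gamma> * (norm \<Delta>)\<^sup>2\<close>.\<close>
  then obtain u where u: "H *v u = \<Delta>" by (metis surjD)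
  have uHu: "u \<bullet> \<Delta> \<le> \<gamma> * (norm \<Delta>)\<^sup>2"
  proof -
    have "(norm u)\<^sup>2 \<le> \<gamma> * (norm u * norm \<Delta>)"
      using coercive[of u] norm_cauchy_schwarz[of u \<Delta>] \<gamma> u
      by (smt (verit, best) mult_left_mono)
    hence "norm u * norm u \<le> norm u * (\<gamma> * norm \<Delta>)" by (simp add: power2_eq_square mult_ac)
    hence "norm u \<le> \<gamma> * norm \<Delta>" using \<gamma> by (cases "u = 0") auto
    hence "norm u * norm \<Delta> \<le> \<gamma> * norm \<Delta> * norm \<Delta>" by (intro mult_right_mono) auto
    thus ?thesis using norm_cauchy_schwarz[of u \<Delta>] by (simp add: power2_eq_square mult_ac)
  qed
  have H_apply: "H *v z = transpose A *v (Ht *v (A *v z))" for z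
    by (simp only: HA matrix_vector_mul_assoc matrix_mul_assoc)
  have H_quad: "z \<bullet> (H *v z) = (A *v z) \<bullet> (Ht *v (A *v z))" for z
    using wnorm_sq_congruence[of A Ht z] by (simp add: wnorm_sq_def HA)
  have \<Delta>: "\<Delta> = - (transpose A *v e) - H *v \<delta>"
    unfolding \<Delta>_def gx gs e_def \<delta>_def H_apply
    by (simp add: matrix_vector_right_distrib matrix_vector_mult_diff_distrib)
  \<comment> \<open>As \<open>H *v (u + \<delta>) = - (transpose A *v e)\<close>, cancelling
    \<open>transpose A\<close> gives \<open>Ht *v p = - e\<close>. The \<open>H\<close>-energy of
    \<open>u + \<delta>\<close> therefore controls the dual error \<open>e\<close>.\<close>
  define p where "p = A *v (u + \<delta>)"
  have "transpose A *v (Ht *v p) = H *v (u + \<delta>)" by (simp add: p_def H_apply)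
  also have "\<dots> = transpose A *v (- e)"
    using linear_neg[OF matrix_vector_mul_linear, of "transpose A" e]
    by (simp only: matrix_vector_right_distrib u \<Delta>) simp
  finally have eq: "transpose A *v (Ht *v p) = transpose A *v (- e)" .
  obtain A' where "A' ** transpose A = mat 1"
    using transpose_invertible[OF A] by (auto simp: invertible_def)
  with eq have Htp: "Ht *v p = - e"
    by (metis matrix_vector_mul_assoc matrix_vector_mul_lid)
  have "(norm e)\<^sup>2 / max_eigenvalue Ht \<le> p \<bullet> (Ht *v p)"
    using psd_norm_mult_sq_le[OF Ht \<sigma>, of p] by (simp add: Htp)
  also have "\<dots> = (u + \<delta>) \<bullet> (H *v (u + \<delta>))" by (simp add: H_quad p_def)
  also have "\<dots> = u \<bullet> \<Delta> + 2 * (\<Delta> \<bullet> \<delta>) + \<delta> \<bullet> (H *v \<delta>)"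
    using symmetric_inner_commute[OF H, of u \<delta>]
    by (simp add: matrix_vector_right_distrib inner_simps u inner_commute)
  finally have slack: "(norm e)\<^sup>2 / max_eigenvalue Ht
      \<le> \<gamma> * (norm \<Delta>)\<^sup>2 + 2 * (\<Delta> \<bullet> \<delta>) + \<delta> \<bullet> (H *v \<delta>)"
    using uHu by linarith
  have "\<Delta> \<bullet> (y - ws) = - (e \<bullet> (A *v (y - ws))) - \<delta> \<bullet> (H *v (y - ws))"
    unfolding \<Delta> by (simp add: inner_diff_left dot_lmul_matrix symmetric_inner_commute[OF H])
  moreover have "2 * (\<delta> \<bullet> (H *v (y - ws)))
      = wnorm_sq H (y - ws) - wnorm_sq H (x - ws) + \<delta> \<bullet> (H *v \<delta>)"
  proof -
    have x: "x - ws = (y - ws) - \<delta>" by (simp add: \<delta>_def)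
    show ?thesis unfolding wnorm_sq_def x
      using symmetric_inner_commute[OF H, of "y - ws" \<delta>]
      by (simp add: matrix_vector_mult_diff_distrib inner_diff_left inner_diff_right inner_commute)
  qed
  moreover have "\<Delta> \<bullet> (x - ws) = \<Delta> \<bullet> (y - ws) - \<Delta> \<bullet> \<delta>"
    by (simp add: \<delta>_def inner_diff_right)
  moreover have "R = - (e \<bullet> (A *v (y - ws))) + (wnorm_sq H (x - ws) - wnorm_sq H (y - ws)) / 2
    - (norm e)\<^sup>2 / max_eigenvalue Ht / 2"
    by (simp add: R_def e_def)
  moreover define X where "X = (norm e)\<^sup>2 / max_eigenvalue Ht"
  ultimately have R: "\<Delta> \<bullet> (x - ws) - \<gamma> / 2 * (norm \<Delta>)\<^sup>2 \<le> R"
    using slack unfolding X_def[symmetric] by (simp add: field_simps)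
  have sum: "(\<phi> x - \<phi> ws - grad \<phi> ws \<bullet> (x - ws)) + (\<phi> ws - \<phi> x - grad \<phi> x \<bullet> (ws - x)) = \<Delta> \<bullet> (x - ws)"
    by (simp add: \<Delta>_def inner_diff_left inner_diff_right)
  have "\<gamma> / 2 * (norm \<Delta>)\<^sup>2 \<le> \<phi> x - \<phi> ws - grad \<phi> ws \<bullet> (x - ws)"
    unfolding \<Delta>_def by (rule bregman_ge_norm_grad_diff[OF \<gamma> conv smooth])
  with sum R show "\<phi> ws - \<phi> x - grad \<phi> x \<bullet> (ws - x) \<le> R" by linarith
  have "\<gamma> / 2 * (norm \<Delta>)\<^sup>2 \<le> \<phi> ws - \<phi> x - grad \<phi> x \<bullet> (ws - x)"
    unfolding \<Delta>_def norm_minus_commute[of "grad \<phi> x"]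
    by (rule bregman_ge_norm_grad_diff[OF \<gamma> conv smooth])
  with sum R show "\<phi> x - \<phi> ws - grad \<phi> ws \<bullet> (x - ws) \<le> R" by linarith
qed

text \<open>The divergences in both directions add up to \<open>(p - ps) \<bullet> (v - vs)\<close>,
  and strong convexity bounds the reverse one from below. Both values of \<open>g\<close> are finite
  because subgradients exist there.\<close>

lemma strongly_convex_bregman_le:
  assumes "strongly_convex lam g" "p \<in> subdifferential g v" "ps \<in> subdifferential g vs"
  obtains d where "bregman g ps vs v = ereal d"
    "d \<le> (p - ps) \<bullet> (v - vs) - lam / 2 * (norm (v - vs))\<^sup>2"
proof -
  obtain a b where ab: "g v = ereal a" "g vs = ereal b"
    using assms(2,3) by (auto simp: subdifferential_def)
  have "ereal (lam / 2 * (norm (v - vs))\<^sup>2) \<le> bregman g p v vs"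
    using assms by (simp add: strongly_convex_def)
  hence "a - b - ps \<bullet> (v - vs) \<le> (p - ps) \<bullet> (v - vs) - lam / 2 * (norm (v - vs))\<^sup>2"
    by (simp add: bregman_def ab inner_diff_left inner_diff_right)
  thus thesis by (intro that[of "a - b - ps \<bullet> (v - vs)"]) (simp_all add: bregman_def ab)
qed

text \<open>The gap is a multiple of the square of
  \<open>norm ((1 - \<kappa>) *\<^sub>R x - \<kappa> *\<^sub>R y)\<close>.\<close>

lemma norm_add_sq_le_weighted:
  fixes x y :: "'a::real_inner"
  assumes "0 < \<kappa>" "\<kappa> < 1"
  shows "(norm (x + y))\<^sup>2 \<le> (norm x)\<^sup>2 / \<kappa> + (norm y)\<^sup>2 / (1 - \<kappa>)"
proof -
  have "0 \<le> (norm ((1 - \<kappa>) *\<^sub>R x - \<kappa> *\<^sub>R y))\<^sup>2 / (\<kappa> * (1 - \<kappa>))" using assms by simp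
  also have "\<dots> = (norm x)\<^sup>2 / \<kappa> + (norm y)\<^sup>2 / (1 - \<kappa>) - (norm (x + y))\<^sup>2"
    using assms unfolding power2_norm_eq_inner
    by (simp add: inner_simps inner_commute[of y x] field_simps)
  finally show ?thesis by simp
qed

text \<open>One iteration in abstract form; primes mark the previous iterate. \<open>h\<close> and
  \<open>q\<close> stand for the \<open>H\<close>-energy of the \<open>w\<close>-error and the
  \<open>G\<close>-energy of the \<open>v\<close>-error, \<open>r\<close> for the
  \<open>G\<close>-energy of the \<open>v\<close>-step, \<open>n\<close> for the norm of the
  \<open>v\<close>-error, \<open>D\<close> and \<open>E\<close> for the divergences.\<close>

lemma energy_contraction:
  fixes e e' a a' b :: "'a::real_inner"
  assumes pos: "0 < \<rho>" "0 < \<theta>" "0 \<le> s" "s < 1" "0 < S" "0 \<le> r"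
    and dual: "e = e' + \<rho> *\<^sub>R (a - b)"
    and D: "D \<le> - (e \<bullet> a) + (h' - h) / 2 - (norm e)\<^sup>2 / (2 * S)"
    and E: "E \<le> (e - \<rho> *\<^sub>R (a - a')) \<bullet> b - \<rho> / 2 * (q + r - q') - lam / 2 * n\<^sup>2"
    and h': "h' \<le> S * (norm a')\<^sup>2" and q: "q \<le> \<eta> * n\<^sup>2" and b: "(norm b)\<^sup>2 \<le> \<beta> * n\<^sup>2"
    and \<theta>S: "\<theta> * S \<le> s * \<rho>"
    and \<theta>lam: "\<theta> * ((\<rho> + S) * \<beta> + (1 - s) * \<rho> * \<eta>) \<le> (1 - s) * lam"
  shows "(1 + \<theta>) * (D + E + (h / 2 + \<rho> / 2 * (norm a)\<^sup>2 + (1 + \<theta>) / (2 * \<rho>) * (norm e)\<^sup>2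
           + \<rho> * (1 + \<theta>) / 2 * q))
    \<le> h' / 2 + \<rho> / 2 * (norm a')\<^sup>2 + (1 + \<theta>) / (2 * \<rho>) * (norm e')\<^sup>2 + \<rho> * (1 + \<theta>) / 2 * q'"
proof -
  define N where "N = (norm (a' - b))\<^sup>2"
  \<comment> \<open>By \<open>dual\<close>, \<open>a - b\<close> is \<open>e - e'\<close> divided by
    \<open>\<rho>\<close>. Polarizing both products produces the squared norm of
    \<open>a - b\<close> with opposite signs, so only \<open>N\<close> remains.\<close>
  have three_point: "- (e \<bullet> a) + (e - \<rho> *\<^sub>R (a - a')) \<bullet> b
      = ((norm e')\<^sup>2 - (norm e)\<^sup>2) / (2 * \<rho>) + \<rho> / 2 * ((norm a')\<^sup>2 - (norm a)\<^sup>2) - \<rho> / 2 * N"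
  proof -
    have e': "e' = e - \<rho> *\<^sub>R (a - b)" using dual by simp
    show ?thesis using pos(1) unfolding N_def power2_norm_eq_inner e'
      by (simp add: inner_simps inner_commute field_simps)
  qed
  \<comment> \<open>The dual surplus raises the weight of the dual energy from 1 to
    \<open>1 + \<theta>\<close>.\<close>
  have "\<theta> * (norm e)\<^sup>2 / (2 * \<rho>) \<le> (norm e)\<^sup>2 / (2 * S)"
  proof -
    have "\<theta> * S \<le> \<rho>" using \<theta>S pos by (smt (verit) mult_le_cancel_right1)
    hence "\<theta> * S * (norm e)\<^sup>2 \<le> \<rho> * (norm e)\<^sup>2" by (intro mult_right_mono) auto
    thus ?thesis using pos by (simp add: field_simps)
  qed
  moreover have "(1 + \<theta>) / (2 * \<rho>) * (norm e)\<^sup>2 = (norm e)\<^sup>2 / (2 * \<rho>) + \<theta> * (norm e)\<^sup>2 / (2 * \<rho>)"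
    by (simp add: algebra_simps add_divide_distrib)
  moreover have "0 \<le> \<rho> / 2 * r" using pos by simp
  moreover define X where "X = (norm e)\<^sup>2 / (2 * S)"
  ultimately have sum: "D + E + (h / 2 + \<rho> / 2 * (norm a)\<^sup>2 + (1 + \<theta>) / (2 * \<rho>) * (norm e)\<^sup>2
           + \<rho> * (1 + \<theta>) / 2 * q)
      \<le> h' / 2 + (norm e')\<^sup>2 / (2 * \<rho>) + \<rho> / 2 * (norm a')\<^sup>2 - \<rho> / 2 * N
        + \<rho> / 2 * q' + \<rho> * \<theta> / 2 * q - lam / 2 * n\<^sup>2"
    using D E three_point unfolding X_def[symmetric]
    by (simp add: algebra_simps add_divide_distrib diff_divide_distrib)
  \<comment> \<open>With this weight the coefficient of \<open>N\<close> is small enough exactly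
    when \<open>\<theta> * S \<le> s * \<rho>\<close>, and the complementary weight
    \<open>(1 - s) / (1 + \<theta>)\<close> fits the bound \<open>\<theta>lam\<close>.\<close>
  define \<kappa> where "\<kappa> = (s + \<theta>) / (1 + \<theta>)"
  have \<kappa>: "0 < \<kappa>" "\<kappa> < 1" "1 - \<kappa> = (1 - s) / (1 + \<theta>)"
    using pos by (auto simp: \<kappa>_def field_simps)
  have "(norm a')\<^sup>2 \<le> N / \<kappa> + (norm b)\<^sup>2 / (1 - \<kappa>)"
    using norm_add_sq_le_weighted[OF \<kappa>(1,2), of "a' - b" b] by (simp add: N_def)
  also have "\<dots> \<le> N / \<kappa> + \<beta> * n\<^sup>2 / (1 - \<kappa>)"
    using b \<kappa>(1,2) by (intro add_left_mono divide_right_mono) auto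
  finally have "\<theta> * (\<rho> + S) * (norm a')\<^sup>2 \<le> \<theta> * (\<rho> + S) * (N / \<kappa> + \<beta> * n\<^sup>2 / (1 - \<kappa>))"
    using pos by (intro mult_left_mono) auto
  also have "\<dots> = (1 + \<theta>) * (\<theta> * (\<rho> + S) / (s + \<theta>) * N + \<theta> * (\<rho> + S) * \<beta> / (1 - s) * n\<^sup>2)"
    using pos unfolding \<kappa>(3) by (simp add: \<kappa>_def field_simps)
  also have "\<dots> \<le> (1 + \<theta>) * (\<rho> * N + (lam - \<theta> * \<rho> * \<eta>) * n\<^sup>2)"
  proof -
    have "\<theta> * (\<rho> + S) / (s + \<theta>) \<le> \<rho>"
      using \<theta>S pos by (simp add: field_simps)
    moreover have "\<theta> * (\<rho> + S) * \<beta> / (1 - s) \<le> lam - \<theta> * \<rho> * \<eta>"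
      using \<theta>lam pos by (simp add: field_simps)
    ultimately show ?thesis using pos
      by (intro mult_left_mono add_mono mult_right_mono) (auto simp: N_def)
  qed
  also have "\<dots> \<le> (1 + \<theta>) * (\<rho> * N + lam * n\<^sup>2 - \<theta> * \<rho> * q)"
  proof -
    have "\<theta> * \<rho> * q \<le> \<theta> * \<rho> * (\<eta> * n\<^sup>2)" using q pos by (intro mult_left_mono) auto
    thus ?thesis using pos by (intro mult_left_mono) (auto simp: algebra_simps)
  qed
  finally have key: "\<theta> * (\<rho> + S) * (norm a')\<^sup>2 \<le> (1 + \<theta>) * (\<rho> * N + lam * n\<^sup>2 - \<theta> * \<rho> * q)" .
  have "\<theta> * h' \<le> \<theta> * (S * (norm a')\<^sup>2)" using h' pos by (intro mult_left_mono) auto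
  with key have key': "\<theta> * h' + \<theta> * \<rho> * (norm a')\<^sup>2 \<le> (1 + \<theta>) * (\<rho> * N + lam * n\<^sup>2 - \<theta> * \<rho> * q)"
    by (simp add: algebra_simps)
  have "(1 + \<theta>) * (D + E + (h / 2 + \<rho> / 2 * (norm a)\<^sup>2 + (1 + \<theta>) / (2 * \<rho>) * (norm e)\<^sup>2
           + \<rho> * (1 + \<theta>) / 2 * q))
    \<le> (1 + \<theta>) * (h' / 2 + (norm e')\<^sup>2 / (2 * \<rho>) + \<rho> / 2 * (norm a')\<^sup>2 - \<rho> / 2 * N
        + \<rho> / 2 * q' + \<rho> * \<theta> / 2 * q - lam / 2 * n\<^sup>2)"
    using sum pos by (intro mult_left_mono) auto
  \<comment> \<open>Multiplication by \<open>1 + \<theta>\<close> yields the weights of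
    \<open>e'\<close> and \<open>q'\<close> in the energy; the excess in \<open>h'\<close> and
    \<open>a'\<close> is what \<open>key'\<close> covers.\<close>
  also have "\<dots> = h' / 2 + \<rho> / 2 * (norm a')\<^sup>2 + (1 + \<theta>) / (2 * \<rho>) * (norm e')\<^sup>2
      + \<rho> * (1 + \<theta>) / 2 * q' + (\<theta> * h' + \<theta> * \<rho> * (norm a')\<^sup>2
        - (1 + \<theta>) * (\<rho> * N + lam * n\<^sup>2 - \<theta> * \<rho> * q)) / 2"
    using pos by (simp add: field_simps)
  also have "\<dots> \<le> h' / 2 + \<rho> / 2 * (norm a')\<^sup>2 + (1 + \<theta>) / (2 * \<rho>) * (norm e')\<^sup>2
      + \<rho> * (1 + \<theta>) / 2 * q'"
    using key' by simp
  finally show ?thesis .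
qed

section \<open>Linear convergence rate of the iterates\<close>

theorem corollary3p3:
  fixes \<phi> :: "real^'n \<Rightarrow> real" and g :: "real^'m \<Rightarrow> ereal"
    and A H Ht :: "real^'n^'n" and B :: "real^'m^'n" and c :: "real^'n"
    and G :: "real^'m^'m"
    and \<gamma> lam \<rho> s \<theta> :: real
    and w \<alpha> \<alpha>t :: "nat \<Rightarrow> real^'n" and v :: "nat \<Rightarrow> real^'m"
    and ws \<alpha>s :: "real^'n" and vs :: "real^'m"
    and T :: nat
  assumes "\<gamma> > 0" and "lam > 0" and "\<rho> > 0"
    and "convex_on UNIV \<phi>" and "smooth (1 / \<gamma>) \<phi>"
    and "proper_convex g" and "strongly_convex lam g"
    and "invertible A"
    and "sym_psd G" and "sym_psd H" and "sym_psd Ht"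
    and "H = transpose A ** Ht ** A"
    and "min_eigenvalue H \<ge> 1 / \<gamma>"
    and "0 \<le> s" and "s < 1" and "\<theta> > 0"
    and "ereal \<theta> \<le> Min
          {ext_frac (\<rho> * (min_eigenvalue (psd_sqrt (A ** transpose A)))\<^sup>2) (min_eigenvalue H),
           ext_frac (s * \<rho>) (max_eigenvalue Ht),
           ext_frac ((1 - s) * lam)
             ((\<rho> + max_eigenvalue Ht) * (max_singular_value B)\<^sup>2
               + (1 - s) * \<rho> * max_singular_value G)}"
    and "A *v ws - B *v vs - c = 0"
    and "transpose A *v \<alpha>s = - grad \<phi> ws"
    and "ws \<in> subdifferential (conjugate (\<lambda>x. ereal (\<phi> x))) (- (transpose A *v \<alpha>s))"
    and "transpose B *v \<alpha>s \<in> subdifferential g vs"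
    and "prec_lin_admm \<phi> g A B c \<rho> G H w v \<alpha>"
    and "\<And>t. t \<ge> 1 \<Longrightarrow> \<alpha>t t = \<alpha> t + Ht *v (A *v (w t - w (t - 1)))"
    and "T \<ge> 1"
  shows "(\<Sum>t = 1..T. ereal ((1 + \<theta>) powi (int t - int T)) *
            (max (bregman (\<lambda>x. ereal (\<phi> x)) (grad \<phi> ws) ws (w (t - 1)))
                 (bregman (conjugate (\<lambda>x. ereal (\<phi> x))) ws
                    (- (transpose A *v \<alpha>s)) (- (transpose A *v \<alpha>t t)))
             + bregman g (transpose B *v \<alpha>s) vs (v t)))
          + ereal (1 / 2 * wnorm_sq H (w T - ws)
             + \<rho> / 2 * (norm (A *v (w T - ws)))\<^sup>2
             + (1 + \<theta>) / (2 * \<rho>) * (norm (\<alpha> T - \<alpha>s))\<^sup>2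
             + \<rho> * (1 + \<theta>) / 2 * wnorm_sq G (v T - vs))
         \<le> ereal ((1 + \<theta>) powi (- int T) / 2 *
             ((\<rho> + max_eigenvalue Ht) * (norm (A *v (w 0 - ws)))\<^sup>2
              + (1 + \<theta>) / \<rho> * (norm (\<alpha> 0 - \<alpha>s))\<^sup>2
              + \<rho> * (1 + \<theta>) * wnorm_sq G (v 0 - vs)))"

proof -
  define S where "S = max_eigenvalue Ht"
  define \<beta> where "\<beta> = max_singular_value B"
  define \<eta> where "\<eta> = max_singular_value G"
  define P where "P t = wnorm_sq H (w t - ws) / 2 + \<rho> / 2 * (norm (A *v (w t - ws)))\<^sup>2
      + (1 + \<theta>) / (2 * \<rho>) * (norm (\<alpha> t - \<alpha>s))\<^sup>2 + \<rho> * (1 + \<theta>) / 2 * wnorm_sq G (v t - vs)" for t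
  define bw where "bw t = max (bregman (\<lambda>x. ereal (\<phi> x)) (grad \<phi> ws) ws (w (t - 1)))
                 (bregman (conjugate (\<lambda>x. ereal (\<phi> x))) ws
                    (- (transpose A *v \<alpha>s)) (- (transpose A *v \<alpha>t t)))" for t
  define bv where "bv t = bregman g (transpose B *v \<alpha>s) vs (v t)" for t
  note pos = \<open>\<gamma> > 0\<close> \<open>lam > 0\<close> \<open>\<rho> > 0\<close> \<open>0 \<le> s\<close> \<open>s < 1\<close> \<open>\<theta> > 0\<close>
  have G: "transpose G = G" and Gpsd: "\<And>x. 0 \<le> wnorm_sq G x"
    and H: "transpose H = H" and Ht: "transpose Ht = Ht"
    using \<open>sym_psd G\<close> \<open>sym_psd H\<close> \<open>sym_psd Ht\<close> by (auto simp: sym_psd_def wnorm_sq_def)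
  have "0 < 1 / \<gamma>" using pos by simp
  hence "0 < min_eigenvalue H" using \<open>min_eigenvalue H \<ge> 1 / \<gamma>\<close> by linarith
  hence S: "0 < S"
    unfolding S_def using max_eigenvalue_pos[OF \<open>H = transpose A ** Ht ** A\<close> Ht H] by simp
  have \<beta>: "0 \<le> \<beta>" and \<eta>: "0 \<le> \<eta>"
    by (simp_all add: \<beta>_def \<eta>_def max_singular_value_nonneg)
  have \<theta>S: "\<theta> * S \<le> s * \<rho>"
    by (rule le_ext_frac) (use assms(17) S pos in \<open>auto simp: S_def\<close>)
  have \<theta>lam: "\<theta> * ((\<rho> + S) * \<beta>\<^sup>2 + (1 - s) * \<rho> * \<eta>) \<le> (1 - s) * lam"
    by (rule le_ext_frac) (use assms(17) S pos \<eta> in \<open>auto simp: S_def \<beta>_def \<eta>_def\<close>)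
  have H_le: "wnorm_sq H x \<le> S * (norm (A *v x))\<^sup>2" for x
  proof -
    have "wnorm_sq H x = (A *v x) \<bullet> (Ht *v (A *v x))"
      using wnorm_sq_congruence[of A Ht x] by (simp add: wnorm_sq_def \<open>H = transpose A ** Ht ** A\<close>)
    thus ?thesis unfolding S_def using inner_le_max_eigenvalue[OF Ht] by simp
  qed
  have G_le: "wnorm_sq G x \<le> \<eta> * (norm x)\<^sup>2" for x
  proof -
    have "wnorm_sq G x \<le> norm x * norm (G *v x)"
      unfolding wnorm_sq_def by (rule norm_cauchy_schwarz)
    also have "\<dots> \<le> norm x * (\<eta> * norm x)"
      unfolding \<eta>_def by (intro mult_left_mono norm_mult_le_max_singular_value) simp
    finally show ?thesis by (simp add: power2_eq_square mult_ac)
  qed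
  have B_le: "(norm (B *v x))\<^sup>2 \<le> \<beta>\<^sup>2 * (norm x)\<^sup>2" for x
    using power_mono[OF norm_mult_le_max_singular_value[of B x], of 2]
    by (simp add: \<beta>_def power_mult_distrib)
  have diff: "\<phi> differentiable (at x)" for x
    using \<open>smooth (1 / \<gamma>) \<phi>\<close> by (simp add: smooth_def)
  note conj = conjugate_at_grad[OF \<open>convex_on UNIV \<phi>\<close> diff]
  have gs: "grad \<phi> ws = - (transpose A *v \<alpha>s)" using assms(19) by simp
  \<comment> \<open>All divergences at the iterates are finite, so contraction and telescoping take
    place in the reals.\<close>
  have "\<exists>D E. bw t = ereal D \<and> bv t = ereal E \<and> (1 + \<theta>) * (D + E + P t) \<le> P (t - 1)"
    if t: "1 \<le> t" for t
  proof -
    note gw = admm_w_update_stationary[OF \<open>prec_lin_admm \<phi> g A B c \<rho> G H w v \<alpha>\<close> t H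
        \<open>H = transpose A ** Ht ** A\<close>]
    define R where "R = - ((\<alpha> t - \<alpha>s) \<bullet> (A *v (w t - ws)))
      + (wnorm_sq H (w (t - 1) - ws) - wnorm_sq H (w t - ws)) / 2 - (norm (\<alpha> t - \<alpha>s))\<^sup>2 / (2 * S)"
    note bounds = bregman_le_H_energy[OF pos(1) \<open>convex_on UNIV \<phi>\<close> \<open>smooth (1 / \<gamma>) \<phi>\<close>
        \<open>invertible A\<close> H \<open>sym_psd Ht\<close> \<open>H = transpose A ** Ht ** A\<close> \<open>min_eigenvalue H \<ge> 1 / \<gamma>\<close> gw gs]
    define D where "D = max (\<phi> (w (t - 1)) - \<phi> ws - grad \<phi> ws \<bullet> (w (t - 1) - ws))
      (\<phi> ws - \<phi> (w (t - 1)) - grad \<phi> (w (t - 1)) \<bullet> (ws - w (t - 1)))"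
    \<comment> \<open>The shifted dual variable turns the second conjugate argument into a gradient
      of \<open>\<phi>\<close>, so \<open>conj\<close> evaluates the conjugate at both
      points.\<close>
    have \<alpha>t: "- (transpose A *v \<alpha>t t) = grad \<phi> (w (t - 1))"
      using gw assms(23)[OF t] by simp
    have "bw t = ereal D"
      unfolding bw_def \<alpha>t gs[symmetric] bregman_def conj D_def
      by (simp add: inner_diff_left inner_diff_right inner_commute algebra_simps)
    have "D \<le> R" using bounds by (simp add: D_def R_def S_def)
    obtain E where E: "bv t = ereal E"
      "E \<le> (transpose B *v (\<alpha> t - \<rho> *\<^sub>R (A *v (w t - w (t - 1)))) - \<rho> *\<^sub>R (G *v (v t - v (t - 1)))
            - transpose B *v \<alpha>s) \<bullet> (v t - vs) - lam / 2 * (norm (v t - vs))\<^sup>2"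
      unfolding bv_def
      using strongly_convex_bregman_le[OF \<open>strongly_convex lam g\<close>
        admm_v_update_subgradient[OF \<open>prec_lin_admm \<phi> g A B c \<rho> G H w v \<alpha>\<close> t \<open>proper_convex g\<close> G]
        \<open>transpose B *v \<alpha>s \<in> subdifferential g vs\<close>] by blast
    have G_three_point: "\<rho> * ((G *v (v t - v (t - 1))) \<bullet> (v t - vs))
        = \<rho> / 2 * (wnorm_sq G (v t - vs) + wnorm_sq G (v t - v (t - 1)) - wnorm_sq G (v (t - 1) - vs))"
    proof -
      define z d where "z = v t - vs" and "d = v t - v (t - 1)"
      have "v (t - 1) - vs = z - d" by (simp add: z_def d_def)
      thus ?thesis
        unfolding wnorm_sq_def z_def[symmetric] d_def[symmetric]
        using symmetric_inner_commute[OF G, of d z]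
        by (simp add: matrix_vector_mult_diff_distrib inner_diff_left inner_diff_right inner_commute)
    qed
    have "E \<le> (\<alpha> t - \<alpha>s - \<rho> *\<^sub>R (A *v (w t - ws) - A *v (w (t - 1) - ws))) \<bullet> (B *v (v t - vs))
        - \<rho> / 2 * (wnorm_sq G (v t - vs) + wnorm_sq G (v t - v (t - 1)) - wnorm_sq G (v (t - 1) - vs))
        - lam / 2 * (norm (v t - vs))\<^sup>2"
    proof -
      have eq: "(transpose B *v (\<alpha> t - \<rho> *\<^sub>R (A *v (w t - w (t - 1)))) - \<rho> *\<^sub>R (G *v (v t - v (t - 1)))
            - transpose B *v \<alpha>s) \<bullet> (v t - vs)
          = (\<alpha> t - \<rho> *\<^sub>R (A *v (w t - w (t - 1))) - \<alpha>s) \<bullet> (B *v (v t - vs))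
            - \<rho> * ((G *v (v t - v (t - 1))) \<bullet> (v t - vs))"
        by (simp only: inner_diff_left inner_scaleR_left inner_transpose_mult)
      have eq': "\<alpha> t - \<rho> *\<^sub>R (A *v (w t - w (t - 1))) - \<alpha>s
          = \<alpha> t - \<alpha>s - \<rho> *\<^sub>R (A *v (w t - ws) - A *v (w (t - 1) - ws))"
        by (simp add: matrix_vector_mult_diff_distrib)
      show ?thesis using E(2) unfolding eq eq' G_three_point .
    qed
    moreover have "\<alpha> t - \<alpha>s = \<alpha> (t - 1) - \<alpha>s + \<rho> *\<^sub>R (A *v (w t - ws) - B *v (v t - vs))"
    proof -
      have "A *v (w t - ws) - B *v (v t - vs) = A *v w t - B *v v t - c - (A *v ws - B *v vs - c)"
        by (simp add: matrix_vector_mult_diff_distrib)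
      thus ?thesis
        using \<open>prec_lin_admm \<phi> g A B c \<rho> G H w v \<alpha>\<close> t \<open>A *v ws - B *v vs - c = 0\<close>
        by (simp add: prec_lin_admm_def)
    qed
    \<comment> \<open>The constant \<open>\<beta>\<close> of the energy lemma is instantiated with
      \<open>\<beta>\<^sup>2\<close>, the squared largest singular value of
      \<open>B\<close>.\<close>
    ultimately have "(1 + \<theta>) * (D + E + P t) \<le> P (t - 1)"
      unfolding P_def
      using \<open>D \<le> R\<close> unfolding R_def
      by (intro energy_contraction[OF pos(3,6,4,5) S Gpsd _ _ _ H_le G_le B_le \<theta>S \<theta>lam])
    with \<open>bw t = ereal D\<close> E(1) show ?thesis by blast
  qed
  then obtain D E where DE: "\<And>t. 1 \<le> t \<Longrightarrow> bw t = ereal (D t) \<and> bv t = ereal (E t)"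
    and step: "\<And>t. 1 \<le> t \<Longrightarrow> (1 + \<theta>) * (D t + E t + P t) \<le> P (t - 1)"
    by metis
  have "(\<Sum>t = 1..T. (1 + \<theta>) powi (int t - int T) * (D t + E t)) + P T
      \<le> (1 + \<theta>) powi (- int T) * P 0"
    using pos step by (intro telescope_linear_rate) auto
  \<comment> \<open>Bounding the initial \<open>H\<close>-energy through \<open>S\<close> creates
    the coefficient \<open>\<rho> + S\<close>.\<close>
  also have "\<dots> \<le> (1 + \<theta>) powi (- int T) * (((\<rho> + S) * (norm (A *v (w 0 - ws)))\<^sup>2
              + (1 + \<theta>) / \<rho> * (norm (\<alpha> 0 - \<alpha>s))\<^sup>2
              + \<rho> * (1 + \<theta>) * wnorm_sq G (v 0 - vs)) / 2)"
    using H_le[of "w 0 - ws"] pos unfolding P_def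
    by (intro mult_left_mono) (auto simp: field_simps)
  finally have final: "(\<Sum>t = 1..T. (1 + \<theta>) powi (int t - int T) * (D t + E t)) + P T \<le> \<dots>" .
  have "(\<Sum>t = 1..T. ereal ((1 + \<theta>) powi (int t - int T)) * (bw t + bv t))
      = ereal (\<Sum>t = 1..T. (1 + \<theta>) powi (int t - int T) * (D t + E t))"
    unfolding sum_ereal[symmetric] by (intro sum.cong) (auto simp: DE)
  thus ?thesis
    using final unfolding bw_def[symmetric] bv_def[symmetric]
    by (simp add: P_def S_def)
qed

end
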